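(* Let $q$ be a prime power and let \[d=\begin{cases}8q-6, & q \text{ even},\\ 8q-4, & q \text{ odd}.\end{cases}\] Then \[AC(d,2)\ \ge\ \begin{cases}\dfrac{25}{64}(d-2)^2, & q \text{ even},\\[2mm] \dfrac{25}{64}(d-4)^2, & q \text{ odd}.\end{cases}\]
   Context: For a group $G$ and a subset $S\subseteq G$ with $S^{-1}=S$ and $e\notin S$, the Cayley graph $\Gamma(G,S)$ has vertex set $G$, with distinct $g,h$ adjacent iff $g^{-1}h\in S$; it is $\#S$-regular. $AC(d,k)$ denotes the largest order of a Cayley graph $\Gamma(G,S)$ with $G$ abelian, of valency (degree) $d$ and diameter $k$. *)

theory Defs
  imports
    "HOL-Algebra.Group"
    "HOL-Algebra.Coset"
    "HOL-Number_Theory.Prime_Powers"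
    "Graph_Theory.Pair_Digraph"
    "Graph_Theory.Shortest_Path"
begin

definition connection_set :: "('a, 'm) monoid_scheme \<Rightarrow> 'a set \<Rightarrow> bool" where
  "connection_set G S \<longleftrightarrow>
     S \<subseteq> carrier G \<and> (\<lambda>s. inv\<^bsub>G\<^esub> s) ` S = S \<and> \<one>\<^bsub>G\<^esub> \<notin> S"

text \<open>Undirected graphs are represented as symmetric digraphs: each edge is a pair of
  opposite arcs, so that the out-degree of a vertex is its valency.\<close>

definition cayley_graph :: "('a, 'm) monoid_scheme \<Rightarrow> 'a set \<Rightarrow> 'a pair_pre_digraph" where
  "cayley_graph G S =
     \<lparr> pverts = carrier G,
       parcs = {(g, h). g \<in> carrier G \<and> h \<in> carrier G \<and> g \<noteq> h \<and> inv\<^bsub>G\<^esub> g \<otimes>\<^bsub>G\<^esub> h \<in> S} \<rparr>"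

definition regular_graph :: "('a, 'b) pre_digraph \<Rightarrow> nat \<Rightarrow> bool" where
  "regular_graph \<Gamma> d \<longleftrightarrow> (\<forall>v\<in>verts \<Gamma>. out_degree \<Gamma> v = d)"

text \<open>With unit arc costs \<open>wf_digraph.\<mu>\<close> is the graph distance; the diameter of a
  disconnected graph is \<open>\<infinity>\<close>.\<close>

definition graph_diameter :: "('a, 'b) pre_digraph \<Rightarrow> ereal" where
  "graph_diameter \<Gamma> = (SUP u\<in>verts \<Gamma>. SUP v\<in>verts \<Gamma>. wf_digraph.\<mu> \<Gamma> (\<lambda>_. 1) u v)"

text \<open>Requiring the carrier to be a set of natural numbers loses nothing: a finite group is
  isomorphic to a group of this kind, and the isomorphism carries Cayley graphs to Cayley graphs.
  Nor does finiteness: a graph of finite valency and finite diameter is finite.\<close>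

definition abelian_cayley_orders :: "nat \<Rightarrow> nat \<Rightarrow> nat set" where
  "abelian_cayley_orders d k =
     {n. \<exists>(G :: nat monoid) S.
        comm_group G \<and> finite (carrier G) \<and> connection_set G S \<and>
        regular_graph (cayley_graph G S) d \<and>
        graph_diameter (cayley_graph G S) = ereal (real k) \<and>
        n = order G}"

text \<open>The set of orders is always finite (a graph of valency \<open>d\<close> and diameter \<open>k\<close> has at most
  \<open>1 + d + d\<^sup>2 + \<dots> + d\<^sup>k\<close> vertices), so \<open>Max\<close> is the largest order whenever there is one;
  it is unspecified if no such Cayley graph exists.\<close>

definition AC :: "nat \<Rightarrow> nat \<Rightarrow> nat" where
  "AC d k = Max (abelian_cayley_orders d k)"

end

theory Submission
  imports
    Defs
    "HOL-Number_Theory.Residues"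
    "HOL-Algebra.Algebraic_Closure"
    "HOL-Algebra.Elementary_Groups"
begin

text \<open>
  Let \<open>F\<close> be a field with \<open>q\<close> elements and \<open>H = F\<^sup>* \<times> F\<^sup>*\<close>. The two coordinate axes and the diagonal
  are pairwise complementary subgroups \<open>N\<^sub>1, N\<^sub>2, N\<^sub>3\<close> of \<open>H\<close>, and the curve \<open>{(x, 1 - x)}\<close> is almost
  complementary to each of them: its product with \<open>N\<^sub>i\<close> misses a single coset, which adding the
  points \<open>(1, 1)\<close> and \<open>(1, -1)\<close> repairs. Moreover the curve is a generalized difference set: its
  quotients represent every element of \<open>H\<close> outside the \<open>N\<^sub>i\<close>. Now place the completed curve \<open>E\<close>, its
  inverse, and two copies of each \<open>N\<^sub>i\<close> at the eight nonzero elements \<open>\<plusminus>h\<^sub>0, \<dots>, \<plusminus>h\<^sub>3\<close> on the axes of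
  \<open>\<int>\<^sub>5 \<times> \<int>\<^sub>5\<close>. The \<open>24\<close> sums \<open>\<plusminus>h\<^sub>i \<plusminus> h\<^sub>j\<close> with \<open>i < j\<close> are precisely the nonzero elements, so every
  nonzero layer is covered by a product of two complementary pieces, while the zero layer is covered
  by \<open>E E\<^sup>-\<^sup>1\<close> and the \<open>N\<^sub>i\<close>. Since \<open>(1, 1)\<close> and \<open>(1, -1)\<close> coincide exactly in characteristic two, the
  number of connections depends on the parity of \<open>q\<close>.
\<close>

section \<open>Finite fields\<close>

lemma (in cring) binomial_expansion:
  assumes x: "x \<in> carrier R" and y: "y \<in> carrier R"
  shows "(x \<oplus> y) [^] n = (\<Oplus>i\<in>{..n}. [(n choose i)] \<cdot> (x [^] i \<otimes> y [^] (n - i)))"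
proof (induction n)
  case 0
  then show ?case by simp
next
  case (Suc n)
  let ?m = "\<lambda>i. x [^] Suc i \<otimes> y [^] (n - i)"
  let ?f = "\<lambda>i. [(n choose i)] \<cdot> (x [^] i \<otimes> y [^] (n - i))"
  let ?g = "\<lambda>i. [(n choose i)] \<cdot> (x [^] i \<otimes> y [^] (Suc n - i))"
  have x_part: "(\<Oplus>i\<in>{..n}. ?f i) \<otimes> x = (\<Oplus>i\<in>{..n}. [(n choose i)] \<cdot> ?m i)"
    using x y by (subst finsum_ldistr) (auto intro!: finsum_cong' simp: add_pow_ldistr add_pow_rdistr m_ac)
  have "(\<Oplus>i\<in>{..n}. ?f i) \<otimes> y = (\<Oplus>i\<in>{..n}. ?g i)"
    using x y by (subst finsum_ldistr)
      (auto intro!: finsum_cong' simp: add_pow_ldistr add_pow_rdistr m_ac Suc_diff_le)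
  \<comment> \<open>The index \<open>Suc n\<close> adds nothing, since \<open>n choose Suc n\<close>
    vanishes. Splitting off index \<open>0\<close> then shifts the sum, so that its monomials match
    those of the \<open>x\<close> part and Pascal's rule applies.\<close>
  also have "\<dots> = (\<Oplus>i\<in>{..Suc n}. ?g i)"
    using x y by (subst finsum_Suc) (auto simp: binomial_eq_0)
  also have "\<dots> = (\<Oplus>i\<in>{..n}. [(n choose Suc i)] \<cdot> ?m i) \<oplus> y [^] Suc n"
    using x y by (subst finsum_Suc2) auto
  finally have y_part: "(\<Oplus>i\<in>{..n}. ?f i) \<otimes> y = \<dots>" .
  have "(x \<oplus> y) [^] Suc n
      = (\<Oplus>i\<in>{..n}. [(n choose i)] \<cdot> ?m i) \<oplus> ((\<Oplus>i\<in>{..n}. [(n choose Suc i)] \<cdot> ?m i) \<oplus> y [^] Suc n)"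
    unfolding x_part[symmetric] y_part[symmetric] nat_pow_Suc[of "x \<oplus> y"] Suc.IH
    using x y by (intro r_distr) auto
  also have "\<dots> = (\<Oplus>i\<in>{..n}. [(n choose i)] \<cdot> ?m i \<oplus> [(n choose Suc i)] \<cdot> ?m i) \<oplus> y [^] Suc n"
    using x y by (subst finsum_addf) (auto simp: a_assoc)
  also have "\<dots> = (\<Oplus>i\<in>{..n}. [(Suc n choose Suc i)] \<cdot> ?m i) \<oplus> y [^] Suc n"
    using x y by (intro arg_cong2[where f="(\<oplus>)"] finsum_cong') (auto simp: add.nat_pow_mult)
  also have "\<dots> = (\<Oplus>i\<in>{..Suc n}. [(Suc n choose i)] \<cdot> (x [^] i \<otimes> y [^] (Suc n - i)))"
    using x y by (subst finsum_Suc2) auto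
  finally show ?case .
qed

lemma (in cring) add_pow_eq_zero:
  assumes "[(p::nat)] \<cdot> \<one> = \<zero>" "x \<in> carrier R" "p dvd n"
  shows "[n] \<cdot> x = \<zero>"
proof -
  obtain m where "n = p * m" using assms(3) by blast
  moreover have "[p] \<cdot> (\<one> \<otimes> ([m] \<cdot> x)) = \<zero>"
    using assms(1,2) by (subst add_pow_ldistr[symmetric]) auto
  ultimately show ?thesis using assms(2) by (simp add: add.nat_pow_pow mult.commute)
qed

text \<open>A prime \<open>p\<close> divides \<open>p choose i\<close> for \<open>0 < i < p\<close>,
  so only the two extreme terms of the expansion survive. Writing \<open>p = k + 2\<close> allows
  both of them to be split off.\<close>

lemma (in cring) frobenius_add:
  assumes p: "Factorial_Ring.prime (p::nat)" and ch: "[p] \<cdot> \<one> = \<zero>"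
    and x: "x \<in> carrier R" and y: "y \<in> carrier R"
  shows "(x \<oplus> y) [^] p = x [^] p \<oplus> y [^] p"
proof -
  obtain m where m: "p = Suc m" using p prime_gt_0_nat gr0_implies_Suc by blast
  obtain k where k: "m = Suc k" using p m prime_gt_1_nat[OF p] by (cases m) auto
  have "(\<Oplus>i\<in>{..k}. [(p choose Suc i)] \<cdot> (x [^] Suc i \<otimes> y [^] (p - Suc i))) = (\<Oplus>i\<in>{..k}. \<zero>)"
  proof (intro finsum_cong')
    fix i assume "i \<in> {..k}"
    hence "p dvd (p choose Suc i)" using p m k by (intro dvd_choose_prime) auto
    thus "[(p choose Suc i)] \<cdot> (x [^] Suc i \<otimes> y [^] (p - Suc i)) = \<zero>"
      using x y by (intro add_pow_eq_zero[OF ch]) auto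
  qed auto
  moreover have "(x \<oplus> y) [^] p = x [^] p \<oplus>
     ((\<Oplus>i\<in>{..k}. [(p choose Suc i)] \<cdot> (x [^] Suc i \<otimes> y [^] (p - Suc i))) \<oplus> y [^] p)"
    unfolding binomial_expansion[OF x y]
    using x y unfolding m k by (subst finsum_Suc, simp, subst finsum_Suc2) (auto simp del: binomial_Suc_Suc)
  ultimately show ?thesis using x y by simp
qed

lemma (in cring) frobenius_power_add:
  assumes p: "Factorial_Ring.prime (p::nat)" and ch: "[p] \<cdot> \<one> = \<zero>"
    and x: "x \<in> carrier R" and y: "y \<in> carrier R"
  shows "(x \<oplus> y) [^] (p ^ k) = x [^] (p ^ k) \<oplus> y [^] (p ^ k)"
  using x y
proof (induction k)
  case (Suc k)
  have "z [^] (p ^ Suc k) = (z [^] (p ^ k)) [^] p" if "z \<in> carrier R" for z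
    using that by (simp add: nat_pow_pow mult.commute)
  thus ?case using Suc frobenius_add[OF p ch] by simp
qed simp

section \<open>Roots of \<open>X^q - X\<close> and the field with \<open>q\<close> elements\<close>

lemma (in ring_hom_ring) hom_add_pow:
  "x \<in> carrier R \<Longrightarrow> h ([(n::nat)] \<cdot> x) = [n] \<cdot>\<^bsub>S\<^esub> h x"
  by (induction n) (auto simp: R.add.nat_pow_Suc S.add.nat_pow_Suc)

lemma (in cring) add_minus_cancel_common:
  "x \<in> carrier R \<Longrightarrow> y \<in> carrier R \<Longrightarrow> a \<in> carrier R \<Longrightarrow> (x \<oplus> a) \<ominus> (y \<oplus> a) = x \<ominus> y"
  by algebra

lemma (in cring) divides_diff_cancel:
  assumes "d divides (x \<ominus> y)" "d divides x" "d \<in> carrier R" "x \<in> carrier R" "y \<in> carrier R"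
  shows "d divides y"
proof -
  obtain r s where r: "r \<in> carrier R" "x = d \<otimes> r" and s: "s \<in> carrier R" "x \<ominus> y = d \<otimes> s"
    using assms(1,2) unfolding factor_def by blast
  have "y = x \<ominus> (x \<ominus> y)" using assms by algebra
  also have "\<dots> = d \<otimes> (r \<ominus> s)" unfolding s(2) using r s assms(3) by algebra
  finally show ?thesis using r s by (intro dividesI[of "r \<ominus> s"]) auto
qed

text \<open>Writing \<open>Y = X - a\<close>, the Frobenius endomorphism of the polynomial ring gives
  \<open>X\<^sup>q - X = Y\<^sup>q - Y\<close>, which \<open>Y\<^sup>2\<close> does not divide. This avoids derivatives.\<close>

lemma (in domain) count_roots_frobenius_le:
  assumes p: "Factorial_Ring.prime (p::nat)" and ch: "[p] \<cdot> \<one> = \<zero>" and q: "q = p ^ Suc k"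
    and a: "a \<in> carrier R" "a [^] q = a"
    and P: "P = X [^]\<^bsub>poly_ring R\<^esub> q \<ominus>\<^bsub>poly_ring R\<^esub> X"
  shows "count (roots P) a \<le> 1"
proof (rule ccontr)
  interpret UP: domain "poly_ring R"
    using univ_poly_is_domain[OF carrier_is_subring] .
  interpret C: ring_hom_ring R "poly_ring R" poly_of_const
    using canonical_embedding_ring_hom[OF carrier_is_subring] by simp
  have X: "X \<in> carrier (poly_ring R)"
    using var_closed[OF carrier_is_subring] by simp
  have PC: "P \<in> carrier (poly_ring R)" using X P by simp
  have chUP: "[p] \<cdot>\<^bsub>poly_ring R\<^esub> \<one>\<^bsub>poly_ring R\<^esub> = \<zero>\<^bsub>poly_ring R\<^esub>"
    using C.hom_add_pow[of \<one> p] ch by simp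
  \<comment> \<open>\<open>Y\<close> is the coefficient list of \<open>X - a\<close>, leading
    coefficient first; \<open>A\<close> is the constant \<open>a\<close>, which the
    \<open>q\<close>-th power fixes because \<open>a [^] q = a\<close>.\<close>
  define A Y where "A = poly_of_const a" and "Y = [\<one>, \<ominus> a]"
  have A: "A \<in> carrier (poly_ring R)" using a unfolding A_def by simp
  have Y: "Y \<in> carrier (poly_ring R)"
    using a unfolding Y_def sym[OF univ_poly_carrier] polynomial_def by simp
  have XYA: "X = Y \<oplus>\<^bsub>poly_ring R\<^esub> A"
    using a unfolding A_def Y_def var_def poly_of_const_def univ_poly_add by (auto simp: l_neg)
  have Aq: "A [^]\<^bsub>poly_ring R\<^esub> q = A"
    using a C.hom_nat_pow[of a q] unfolding A_def by simp
  have Yq: "Y [^]\<^bsub>poly_ring R\<^esub> q \<in> carrier (poly_ring R)" using Y by simp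
  have PY: "P = Y [^]\<^bsub>poly_ring R\<^esub> q \<ominus>\<^bsub>poly_ring R\<^esub> Y"
  proof -
    have "X [^]\<^bsub>poly_ring R\<^esub> q = Y [^]\<^bsub>poly_ring R\<^esub> q \<oplus>\<^bsub>poly_ring R\<^esub> A"
      using UP.frobenius_power_add[OF p chUP Y A, of "Suc k"] Aq unfolding XYA q by simp
    hence "P = (Y [^]\<^bsub>poly_ring R\<^esub> q \<oplus>\<^bsub>poly_ring R\<^esub> A) \<ominus>\<^bsub>poly_ring R\<^esub> (Y \<oplus>\<^bsub>poly_ring R\<^esub> A)"
      unfolding P XYA[symmetric] by simp
    thus ?thesis using UP.add_minus_cancel_common[OF Yq Y A] by simp
  qed
  assume "\<not> count (roots P) a \<le> 1"
  hence "2 \<le> alg_mult P a" using alg_mult_eq_count_roots[OF PC] by simp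
  hence "Y [^]\<^bsub>poly_ring R\<^esub> (2::nat) pdivides P"
    unfolding Y_def using le_alg_mult_imp_pdivides[OF a(1) PC] by blast
  moreover have "Y [^]\<^bsub>poly_ring R\<^esub> (2::nat) pdivides Y [^]\<^bsub>poly_ring R\<^esub> q"
  proof -
    have "2 \<le> p ^ Suc k"
      using prime_ge_2_nat[OF p] self_le_power[of p "Suc k"] by linarith
    thus ?thesis using polynomial_pow_division[OF Y] unfolding q by simp
  qed
  \<comment> \<open>A double root makes \<open>Y^2\<close> divide \<open>Y^q - Y\<close>; as
    \<open>q \<ge> 2\<close> it divides \<open>Y^q\<close>, hence also \<open>Y\<close>, which has
    degree 1.\<close>
  ultimately have "Y [^]\<^bsub>poly_ring R\<^esub> (2::nat) pdivides Y"
    unfolding PY pdivides_def by (rule UP.divides_diff_cancel[OF _ _ _ Yq Y]) (rule UP.nat_pow_closed[OF Y])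
  hence "degree (Y [^]\<^bsub>poly_ring R\<^esub> (2::nat)) \<le> degree Y"
    using pdivides_imp_degree_le[OF carrier_is_subring _ Y] Y by (simp add: Y_def)
  thus False using polynomial_pow_degree[OF Y, of 2] by (simp add: Y_def)
qed

text \<open>\<open>K\<close> is the root set of \<open>X^q - X\<close>. This polynomial has degree
  \<open>q\<close>, splits over the algebraically closed \<open>L\<close>, and has only simple
  roots.\<close>

lemma (in algebraically_closed) card_frobenius_fixed:
  assumes p: "Factorial_Ring.prime (p::nat)" and ch: "[p] \<cdot> \<one> = \<zero>" and q: "q = p ^ Suc k"
  defines "K \<equiv> {x \<in> carrier L. x [^] q = x}"
  shows "finite K" "card K = q"
proof -
  interpret UP: domain "poly_ring L"
    using univ_poly_is_domain[OF carrier_is_subring] .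
  define P where "P = X [^]\<^bsub>poly_ring L\<^esub> q \<ominus>\<^bsub>poly_ring L\<^esub> X"
  have X: "X \<in> carrier (poly_ring L)"
    using var_closed[OF carrier_is_subring] by simp
  have PC: "P \<in> carrier (poly_ring L)" using X P_def by simp
  have q2: "2 \<le> q"
    using prime_ge_2_nat[OF p] self_le_power[of p "Suc k"] unfolding q by linarith
  have deg: "degree P = q"
  proof -
    have "degree (\<ominus>\<^bsub>poly_ring L\<^esub> X) = 1"
      using univ_poly_a_inv_degree[OF carrier_is_subring X] by (simp add: var_def)
    moreover have "degree (X [^]\<^bsub>poly_ring L\<^esub> q) = q"
      using polynomial_pow_degree[OF X, of q] by (simp add: var_def)
    moreover have "polynomial (carrier L) (X [^]\<^bsub>poly_ring L\<^esub> q)"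
        "polynomial (carrier L) (\<ominus>\<^bsub>poly_ring L\<^esub> X)"
      using X unfolding univ_poly_carrier by auto
    ultimately show ?thesis
      using poly_add_degree_eq[OF carrier_is_subring] q2
      unfolding P_def UP.minus_eq univ_poly_add by simp
  qed
  have "P \<noteq> []" using deg q2 by auto
  have ev: "eval P x = x [^] q \<ominus> x" if x: "x \<in> carrier L" for x
  proof -
    interpret E: ring_hom_ring "poly_ring L" L "\<lambda>p. eval p x"
      using eval_ring_hom[OF carrier_is_subring x] .
    show ?thesis unfolding P_def using X x by (simp add: eval_var UP.minus_eq minus_eq E.hom_nat_pow)
  qed
  have "set_mset (roots P) = K"
    using roots_mem_iff_is_root[OF PC] \<open>P \<noteq> []\<close> ev unfolding is_root_def K_def by auto
  moreover have "count (roots P) x = 1" if "x \<in> K" for x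
  proof -
    have "count (roots P) x \<le> 1"
      using count_roots_frobenius_le[OF p ch q _ _ P_def, of x] that unfolding K_def by simp
    moreover have "count (roots P) x > 0"
      using that \<open>set_mset (roots P) = K\<close> by simp
    ultimately show ?thesis by linarith
  qed
  moreover have "size (roots P) = q"
    using roots_over_carrier[OF PC] deg unfolding splitted_def by simp
  ultimately show "finite K" "card K = q"
    by (auto simp: size_multiset_overloaded_eq)
qed

text \<open>The field consists of the fixed points of \<open>x \<mapsto> x^q\<close> in an algebraic
  closure of the prime field; the element type is that of the closure construction over
  \<open>int\<close>. The last conjunct records the characteristic, which later decides whether
  \<open>1 = -1\<close>.\<close>

lemma exists_finite_field:
  assumes "primepow (q::nat)"
  shows "\<exists>F :: ((int list \<times> nat) multiset \<Rightarrow> int) ring. Ring.field F \<and> finite (carrier F) \<and> card (carrier F) = q \<and>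
    [aprimedivisor q] \<cdot>\<^bsub>F\<^esub> \<one>\<^bsub>F\<^esub> = \<zero>\<^bsub>F\<^esub>"
proof -
  obtain p k where p: "Factorial_Ring.prime p" and q: "q = p ^ Suc k"
    using assms unfolding primepow_def by (metis gr0_implies_Suc)
  define Fp where "Fp = residue_ring (int p)"
  interpret Fp: residues_prime p Fp
    by unfold_locales (use p Fp_def in auto)
  interpret Fp: Ring.field Fp by (rule Fp.is_field)
  obtain L :: "((int list \<times> nat) multiset \<Rightarrow> int) ring"
    where L: "algebraic_closure L (Fp.indexed_const ` carrier Fp)" and hom: "Fp.indexed_const \<in> ring_hom Fp L"
    using Fp.exists_closure by blast
  interpret L: algebraic_closure L "Fp.indexed_const ` carrier Fp" by (rule L)
  interpret h: ring_hom_ring Fp L Fp.indexed_const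
    using hom by (intro ring_hom_ringI2) unfold_locales
  have "[p] \<cdot>\<^bsub>Fp\<^esub> \<one>\<^bsub>Fp\<^esub> = \<zero>\<^bsub>Fp\<^esub>"
  proof -
    have "[n] \<cdot>\<^bsub>Fp\<^esub> \<one>\<^bsub>Fp\<^esub> = int n mod int p" for n
      by (induction n) (auto simp: Fp.add.nat_pow_Suc Fp.res_add_eq Fp.res_one_eq Fp.res_zero_eq mod_simps add_ac)
    thus ?thesis by (simp add: Fp.res_zero_eq)
  qed
  hence ch: "[p] \<cdot>\<^bsub>L\<^esub> \<one>\<^bsub>L\<^esub> = \<zero>\<^bsub>L\<^esub>"
    using h.hom_add_pow[of "\<one>\<^bsub>Fp\<^esub>" p] by simp
  define K where "K = {x \<in> carrier L. x [^]\<^bsub>L\<^esub> q = x}"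
  have add: "x \<oplus>\<^bsub>L\<^esub> y \<in> K" if "x \<in> K" "y \<in> K" for x y
    using that L.frobenius_power_add[OF p ch, of x y "Suc k"] unfolding K_def q by simp
  have "q > 0" using q p prime_gt_0_nat by simp
  \<comment> \<open>Additivity is applied to \<open>-x + x = 0\<close>, so no sign
    \<open>(-1)^q\<close> has to be evaluated.\<close>
  have minus: "\<ominus>\<^bsub>L\<^esub> x \<in> K" if "x \<in> K" for x
  proof -
    have "(\<ominus>\<^bsub>L\<^esub> x) [^]\<^bsub>L\<^esub> q \<oplus>\<^bsub>L\<^esub> x = (\<ominus>\<^bsub>L\<^esub> x \<oplus>\<^bsub>L\<^esub> x) [^]\<^bsub>L\<^esub> q"
      using that L.frobenius_power_add[OF p ch, of "\<ominus>\<^bsub>L\<^esub> x" x "Suc k"] unfolding K_def q by simp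
    also have "\<dots> = \<zero>\<^bsub>L\<^esub>" using that \<open>q > 0\<close> L.l_neg L.nat_pow_zero unfolding K_def by simp
    finally show ?thesis using that L.sum_zero_eq_neg unfolding K_def by simp
  qed
  have "subring K L"
    using add minus by (intro L.subringI) (auto simp: K_def L.nat_pow_distrib)
  moreover have "inv\<^bsub>L\<^esub> x \<in> K" if "x \<in> K - {\<zero>\<^bsub>L\<^esub>}" for x
  proof -
    have x: "x \<in> carrier L" "inv\<^bsub>L\<^esub> x \<in> carrier L" "x \<otimes>\<^bsub>L\<^esub> inv\<^bsub>L\<^esub> x = \<one>\<^bsub>L\<^esub>" "x [^]\<^bsub>L\<^esub> q = x"
      using that L.field_Units unfolding K_def by auto
    have "x \<otimes>\<^bsub>L\<^esub> (inv\<^bsub>L\<^esub> x) [^]\<^bsub>L\<^esub> q = \<one>\<^bsub>L\<^esub>"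
      using L.nat_pow_distrib[OF x(1,2), of q] x by simp
    hence "(inv\<^bsub>L\<^esub> x) [^]\<^bsub>L\<^esub> q = inv\<^bsub>L\<^esub> x"
      using x by (metis L.comm_inv_char L.nat_pow_closed)
    thus ?thesis using x unfolding K_def by simp
  qed
  ultimately have "subfield K L" by (intro L.subfieldI')
  hence "Ring.field (L\<lparr>carrier := K\<rparr>)"
    using L.subfield_iff(2) by blast
  moreover have "finite K" "card K = q"
    using L.card_frobenius_fixed[OF p ch q] unfolding K_def by blast+
  moreover have "[aprimedivisor q] \<cdot>\<^bsub>L\<lparr>carrier := K\<rparr>\<^esub> \<one>\<^bsub>L\<lparr>carrier := K\<rparr>\<^esub> = \<zero>\<^bsub>L\<lparr>carrier := K\<rparr>\<^esub>"
    using ch aprimedivisor_prime_power[OF p, of "Suc k"] unfolding q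
    by (simp add: add_pow_def nat_pow_def del: power_Suc)
  ultimately show ?thesis by (intro exI[of _ "L\<lparr>carrier := K\<rparr>"]) simp
qed

section \<open>Cayley graphs of diameter two\<close>

lemma pverts_cayley_graph [simp]: "pverts (cayley_graph G S) = carrier G"
  by (simp add: cayley_graph_def)

context
  fixes G :: "('a, 'm) monoid_scheme" and S :: "'a set"
  assumes G: "group G" and S: "connection_set G S"
begin

interpretation G: group G by (rule G)

lemma pair_wf_cayley_graph: "pair_wf_digraph (cayley_graph G S)"
  by unfold_locales (auto simp: cayley_graph_def)

interpretation pair_wf_digraph "cayley_graph G S" by (rule pair_wf_cayley_graph)

lemma cayley_arc_iff:
  "(g, h) \<in> parcs (cayley_graph G S) \<longleftrightarrow> g \<in> carrier G \<and> (\<exists>s\<in>S. h = g \<otimes>\<^bsub>G\<^esub> s)"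
proof -
  have SG: "S \<subseteq> carrier G" and S1: "\<one>\<^bsub>G\<^esub> \<notin> S" using S unfolding connection_set_def by auto
  have "h = g \<otimes>\<^bsub>G\<^esub> (inv\<^bsub>G\<^esub> g \<otimes>\<^bsub>G\<^esub> h)" if "g \<in> carrier G" "h \<in> carrier G"
    using that by (simp add: G.m_assoc[symmetric])
  moreover have "inv\<^bsub>G\<^esub> g \<otimes>\<^bsub>G\<^esub> (g \<otimes>\<^bsub>G\<^esub> s) = s" if "g \<in> carrier G" "s \<in> carrier G" for s
    using that by (simp add: G.m_assoc[symmetric])
  moreover have "g \<noteq> g \<otimes>\<^bsub>G\<^esub> s" if "g \<in> carrier G" "s \<in> S" for s
    using that SG S1 G.l_cancel_one'[of g s] by auto
  ultimately show ?thesis unfolding cayley_graph_def using SG by auto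
qed

lemma out_degree_cayley_graph:
  assumes "g \<in> carrier G"
  shows "out_degree (cayley_graph G S) g = card S"
proof -
  have "S \<subseteq> carrier G" using S unfolding connection_set_def by auto
  have "out_arcs (cayley_graph G S) g = (\<lambda>s. (g, g \<otimes>\<^bsub>G\<^esub> s)) ` S"
    using assms by (auto simp: out_arcs_def cayley_arc_iff)
  moreover have "inj_on (\<lambda>s. (g, g \<otimes>\<^bsub>G\<^esub> s)) S"
    using assms \<open>S \<subseteq> carrier G\<close> by (auto simp: inj_on_def subset_iff)
  ultimately show ?thesis unfolding out_degree_def by (simp add: card_image)
qed

lemma regular_cayley_graph_iff: "regular_graph (cayley_graph G S) d \<longleftrightarrow> card S = d"
proof -
  have "verts (cayley_graph G S) = carrier G" by (simp add: cayley_graph_def)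
  thus ?thesis unfolding regular_graph_def using out_degree_cayley_graph by auto
qed

lemma awalk_Cons_cayley_iff:
  "awalk u (e # p) v \<longleftrightarrow> u \<in> carrier G \<and> (\<exists>s\<in>S. e = (u, u \<otimes>\<^bsub>G\<^esub> s) \<and> awalk (u \<otimes>\<^bsub>G\<^esub> s) p v)"
  by (cases e) (auto simp: awalk_Cons_iff cayley_arc_iff)

lemma awalk_cost_one: "awalk_cost (\<lambda>_. 1) p = length p"
  by (induction p) auto

lemma mu_le_iff:
  "\<mu> (\<lambda>_. 1) u v \<le> ereal (real k) \<longleftrightarrow> (\<exists>p. awalk u p v \<and> length p \<le> k)"
proof
  assume "\<mu> (\<lambda>_. 1) u v \<le> ereal (real k)"
  \<comment> \<open>The infimum in \<open>\<mu>\<close> yields an actual walk only from a strict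
    inequality; since lengths are integers, \<open>< k + 1\<close> is as good as
    \<open>\<le> k\<close>.\<close>
  hence "\<mu> (\<lambda>_. 1) u v < ereal (real (Suc k))"
    by (rule le_less_trans) simp
  thus "\<exists>p. awalk u p v \<and> length p \<le> k"
    unfolding \<mu>_def by (auto simp: INF_less_iff awalk_cost_one)
next
  assume "\<exists>p. awalk u p v \<and> length p \<le> k"
  then obtain p where p: "awalk u p v" "length p \<le> k" by blast
  show "\<mu> (\<lambda>_. 1) u v \<le> ereal (real k)"
    using min_cost_le_walk_cost[OF p(1), of "\<lambda>_. 1"] p(2)
    by (intro order_trans[OF min_cost_le_walk_cost[OF p(1)]]) (simp add: awalk_cost_one)
qed

text \<open>The first arc leaves at most \<open>card S\<close> choices for the next vertex. Summed
  over all lengths up to \<open>k\<close>, this becomes a crude Moore bound on the order.\<close>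

lemma card_walk_ends_le:
  assumes "finite (carrier G)"
  shows "card {v. \<exists>p. awalk u p v \<and> length p = n} \<le> card S ^ n"
proof (induction n arbitrary: u)
  case 0
  have "{v. \<exists>p. awalk u p v \<and> length p = 0} \<subseteq> {u}" by (auto simp: awalk_Nil_iff)
  hence "card {v. \<exists>p. awalk u p v \<and> length p = 0} \<le> card {u}"
    by (rule card_mono[rotated]) simp
  thus ?case by simp
next
  case (Suc n)
  have "finite S" using assms S finite_subset unfolding connection_set_def by blast
  let ?W = "\<lambda>u. {v. \<exists>p. awalk u p v \<and> length p = n}"
  have fin: "finite (?W u)" for u
    using assms by (rule rev_finite_subset) (auto dest: awalk_last_in_verts)
  have "{v. \<exists>p. awalk u p v \<and> length p = Suc n} \<subseteq> (\<Union>s\<in>S. ?W (u \<otimes>\<^bsub>G\<^esub> s))"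
  proof
    fix v assume "v \<in> {v. \<exists>p. awalk u p v \<and> length p = Suc n}"
    then obtain e p where "awalk u (e # p) v" "length p = n" by (auto simp: length_Suc_conv)
    thus "v \<in> (\<Union>s\<in>S. ?W (u \<otimes>\<^bsub>G\<^esub> s))" unfolding awalk_Cons_cayley_iff by blast
  qed
  hence "card {v. \<exists>p. awalk u p v \<and> length p = Suc n} \<le> card (\<Union>s\<in>S. ?W (u \<otimes>\<^bsub>G\<^esub> s))"
    using \<open>finite S\<close> fin by (intro card_mono) auto
  also have "\<dots> \<le> (\<Sum>s\<in>S. card (?W (u \<otimes>\<^bsub>G\<^esub> s)))"
    using \<open>finite S\<close> by (rule card_UN_le)
  also have "\<dots> \<le> card S * card S ^ n"
    using sum_bounded_above[of S "\<lambda>s. card (?W (u \<otimes>\<^bsub>G\<^esub> s))" "card S ^ n", OF Suc.IH]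
    unfolding of_nat_id .
  finally show ?case by simp
qed

lemma order_le_of_cayley_diameter:
  assumes fin: "finite (carrier G)"
    and diam: "graph_diameter (cayley_graph G S) = ereal (real k)"
  shows "order G \<le> (\<Sum>n\<le>k. card S ^ n)"
proof -
  have "carrier G \<subseteq> (\<Union>n\<in>{..k}. {v. \<exists>p. awalk \<one>\<^bsub>G\<^esub> p v \<and> length p = n})"
  proof
    fix v assume "v \<in> carrier G"
    hence "\<mu> (\<lambda>_. 1) \<one>\<^bsub>G\<^esub> v \<le> graph_diameter (cayley_graph G S)"
      unfolding graph_diameter_def
      by (intro SUP_upper2[of "\<one>\<^bsub>G\<^esub>"] SUP_upper) auto
    thus "v \<in> (\<Union>n\<in>{..k}. {v. \<exists>p. awalk \<one>\<^bsub>G\<^esub> p v \<and> length p = n})"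
      unfolding diam mu_le_iff by auto
  qed
  moreover have "finite (\<Union>n\<in>{..k}. {v. \<exists>p. awalk \<one>\<^bsub>G\<^esub> p v \<and> length p = n})"
    using fin by (rule rev_finite_subset) (auto dest: awalk_last_in_verts)
  ultimately have "card (carrier G) \<le> card (\<Union>n\<in>{..k}. {v. \<exists>p. awalk \<one>\<^bsub>G\<^esub> p v \<and> length p = n})"
    by (rule card_mono[rotated])
  also have "\<dots> \<le> (\<Sum>n\<le>k. card {v. \<exists>p. awalk \<one>\<^bsub>G\<^esub> p v \<and> length p = n})"
    by (rule card_UN_le) simp
  also have "\<dots> \<le> (\<Sum>n\<le>k. card S ^ n)"
    by (intro sum_mono card_walk_ends_le fin)
  finally show ?thesis unfolding order_def .
qed

text \<open>The distance from \<open>u\<close> to \<open>v\<close> depends only on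
  \<open>inv u \<otimes> v\<close>, so \<open>cover\<close> bounds all distances by 2, while
  \<open>far\<close> supplies a vertex at distance at least 2 from the identity.\<close>

lemma cayley_diameter_eq_2:
  assumes cover: "\<And>g. g \<in> carrier G \<Longrightarrow> g = \<one>\<^bsub>G\<^esub> \<or> g \<in> S \<or> (\<exists>s\<in>S. \<exists>t\<in>S. g = s \<otimes>\<^bsub>G\<^esub> t)"
    and far: "\<exists>g\<in>carrier G. g \<noteq> \<one>\<^bsub>G\<^esub> \<and> g \<notin> S"
  shows "graph_diameter (cayley_graph G S) = 2"
proof (rule antisym)
  have SG: "S \<subseteq> carrier G" using S unfolding connection_set_def by auto
  have "\<exists>p. awalk u p v \<and> length p \<le> 2" if uv: "u \<in> carrier G" "v \<in> carrier G" for u v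
  proof -
    have Nil: "awalk x [] x" if "x \<in> carrier G" for x
      using that by (simp add: awalk_Nil_iff)
    have v: "v = u \<otimes>\<^bsub>G\<^esub> (inv\<^bsub>G\<^esub> u \<otimes>\<^bsub>G\<^esub> v)" using uv by (simp add: G.m_assoc[symmetric])
    consider "inv\<^bsub>G\<^esub> u \<otimes>\<^bsub>G\<^esub> v = \<one>\<^bsub>G\<^esub>" | "inv\<^bsub>G\<^esub> u \<otimes>\<^bsub>G\<^esub> v \<in> S"
      | s t where "s \<in> S" "t \<in> S" "inv\<^bsub>G\<^esub> u \<otimes>\<^bsub>G\<^esub> v = s \<otimes>\<^bsub>G\<^esub> t"
      using cover[of "inv\<^bsub>G\<^esub> u \<otimes>\<^bsub>G\<^esub> v"] uv by auto
    thus ?thesis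
    proof cases
      case 1
      hence "v = u" using v uv by simp
      thus ?thesis using Nil uv by (intro exI[of _ "[]"]) simp
    next
      case 2
      hence "awalk u [(u, v)] v" using v uv Nil unfolding awalk_Cons_cayley_iff by metis
      thus ?thesis by (intro exI[of _ "[(u, v)]"]) simp
    next
      case 3
      hence "v = u \<otimes>\<^bsub>G\<^esub> s \<otimes>\<^bsub>G\<^esub> t" using v uv SG by (metis G.m_assoc subsetD)
      hence "awalk u [(u, u \<otimes>\<^bsub>G\<^esub> s), (u \<otimes>\<^bsub>G\<^esub> s, v)] v"
        using 3 uv Nil SG by (auto simp: awalk_Cons_cayley_iff)
      thus ?thesis by (intro exI[of _ "[(u, u \<otimes>\<^bsub>G\<^esub> s), (u \<otimes>\<^bsub>G\<^esub> s, v)]"]) simp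
    qed
  qed
  hence "\<mu> (\<lambda>_. 1) u v \<le> 2" if "u \<in> carrier G" "v \<in> carrier G" for u v
    using that mu_le_iff[of u v 2] by simp
  thus "graph_diameter (cayley_graph G S) \<le> 2"
    unfolding graph_diameter_def by (intro SUP_least) auto
  obtain g where g: "g \<in> carrier G" "g \<noteq> \<one>\<^bsub>G\<^esub>" "g \<notin> S" using far by blast
  \<comment> \<open>A walk of length 0 from the identity ends there, and one of length 1 ends in
    \<open>S\<close>; the element \<open>g\<close> is excluded from both.\<close>
  have "2 \<le> \<mu> (\<lambda>_. 1) \<one>\<^bsub>G\<^esub> g"
    unfolding \<mu>_def
  proof (rule INF_greatest)
    fix p assume "p \<in> {p. awalk \<one>\<^bsub>G\<^esub> p g}"
    hence p: "awalk \<one>\<^bsub>G\<^esub> p g" by simp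
    have "p \<noteq> []" using p g by (auto simp: awalk_Nil_iff)
    moreover have "length p \<noteq> 1"
      using p g SG
      by (auto simp: length_Suc_conv awalk_Cons_cayley_iff awalk_Nil_iff subset_iff)
    ultimately have "2 \<le> length p" by (cases p rule: list.exhaust) (auto simp: Suc_le_eq)
    thus "2 \<le> ereal (awalk_cost (\<lambda>_. 1) p)" by (simp add: awalk_cost_one)
  qed
  also have "\<dots> \<le> graph_diameter (cayley_graph G S)"
    unfolding graph_diameter_def using g
    by (intro SUP_upper2[of "\<one>\<^bsub>G\<^esub>"] SUP_upper) auto
  finally show "2 \<le> graph_diameter (cayley_graph G S)" .
qed

end

text \<open>\<open>Max_ge\<close> needs this to turn a single member into a lower bound for
  \<open>AC\<close>. It follows from the Moore bound.\<close>

lemma finite_abelian_cayley_orders: "finite (abelian_cayley_orders d k)"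
proof (rule finite_subset)
  show "abelian_cayley_orders d k \<subseteq> {..\<Sum>n\<le>k. d ^ n}"
  proof
    fix n assume "n \<in> abelian_cayley_orders d k"
    then obtain G :: "nat monoid" and S where G: "comm_group G" "finite (carrier G)" "connection_set G S"
        "regular_graph (cayley_graph G S) d" "graph_diameter (cayley_graph G S) = ereal (real k)"
        "n = order G"
      unfolding abelian_cayley_orders_def by blast
    have "group G" using G(1) by (rule comm_group.axioms)
    hence "card S = d" using regular_cayley_graph_iff G(3,4) by blast
    thus "n \<in> {..\<Sum>n\<le>k. d ^ n}"
      using order_le_of_cayley_diameter[OF \<open>group G\<close> G(3,2,5)] G(6) by simp
  qed
qed simp

text \<open>\<open>abelian_cayley_orders\<close> only admits groups of natural numbers, so the group
  is copied along an injection \<open>f\<close> of its carrier into \<open>nat\<close>. The covering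
  property and the far element survive, and the diameter is computed afresh in the copy.\<close>

lemma order_in_abelian_cayley_orders:
  fixes G :: "('a, 'm) monoid_scheme"
  assumes G: "comm_group G" and fin: "finite (carrier G)" and S: "connection_set G S"
    and cover: "\<And>g. g \<in> carrier G \<Longrightarrow> g = \<one>\<^bsub>G\<^esub> \<or> g \<in> S \<or> (\<exists>s\<in>S. \<exists>t\<in>S. g = s \<otimes>\<^bsub>G\<^esub> t)"
    and far: "\<exists>g\<in>carrier G. g \<noteq> \<one>\<^bsub>G\<^esub> \<and> g \<notin> S"
  shows "order G \<in> abelian_cayley_orders (card S) 2"
proof -
  obtain f :: "'a \<Rightarrow> nat" where inj: "inj_on f (carrier G)"
    using finite_imp_inj_to_nat_seg[OF fin] by blast
  interpret G: comm_group G by (rule G)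
  define g where "g = the_inv_into (carrier G) f"
  define H where "H = \<lparr>carrier = f ` carrier G, monoid.mult = (\<lambda>x y. f (g x \<otimes>\<^bsub>G\<^esub> g y)), one = f \<one>\<^bsub>G\<^esub>\<rparr>"
  have gf: "g (f x) = x" if "x \<in> carrier G" for x
    using that inj unfolding g_def by (rule the_inv_into_f_f[rotated])
  interpret H: comm_group H
  proof (rule comm_groupI)
    fix x assume "x \<in> carrier H"
    thus "\<exists>y\<in>carrier H. y \<otimes>\<^bsub>H\<^esub> x = \<one>\<^bsub>H\<^esub>"
      by (auto simp: H_def gf intro!: bexI[of _ "inv\<^bsub>G\<^esub> _"])
  qed (auto simp: H_def gf G.m_ac)
  have hom: "f \<in> hom G H" by (auto simp: hom_def H_def gf)
  interpret f: group_hom G H f by unfold_locales (rule hom)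
  have SG: "S \<subseteq> carrier G" and S1: "\<one>\<^bsub>G\<^esub> \<notin> S" and Sinv: "(\<lambda>s. inv\<^bsub>G\<^esub> s) ` S = S"
    using S unfolding connection_set_def by auto
  have notin: "f x \<notin> f ` S" if "x \<in> carrier G" "x \<notin> S" for x
    using that SG inj by (auto dest: inj_onD)
  have "(\<lambda>s. inv\<^bsub>H\<^esub> s) ` f ` S = f ` (\<lambda>s. inv\<^bsub>G\<^esub> s) ` S"
    unfolding image_image using SG by (intro image_cong) auto
  hence S': "connection_set H (f ` S)"
    unfolding connection_set_def Sinv using SG notin[OF G.one_closed S1] by auto
  have "h = \<one>\<^bsub>H\<^esub> \<or> h \<in> f ` S \<or> (\<exists>s\<in>f ` S. \<exists>t\<in>f ` S. h = s \<otimes>\<^bsub>H\<^esub> t)" if h: "h \<in> carrier H" for h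
  proof -
    obtain x where x: "x \<in> carrier G" "h = f x" using h unfolding H_def by auto
    show ?thesis
      using cover[OF x(1)]
    proof (elim disjE bexE)
      fix s t assume st: "s \<in> S" "t \<in> S" "x = s \<otimes>\<^bsub>G\<^esub> t"
      hence "h = f s \<otimes>\<^bsub>H\<^esub> f t" using SG unfolding x(2) st(3) by (intro f.hom_mult) auto
      thus ?thesis using st by blast
    next
      assume "x = \<one>\<^bsub>G\<^esub>"
      hence "h = \<one>\<^bsub>H\<^esub>" using f.hom_one unfolding x(2) by simp
      thus ?thesis by blast
    next
      assume "x \<in> S"
      thus ?thesis unfolding x(2) by blast
    qed
  qed
  moreover obtain x where x: "x \<in> carrier G" "x \<noteq> \<one>\<^bsub>G\<^esub>" "x \<notin> S" using far by blast
  have "f x \<noteq> \<one>\<^bsub>H\<^esub>"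
    using inj_onD[OF inj _ x(1) G.one_closed] x(2) f.hom_one by metis
  hence "\<exists>h\<in>carrier H. h \<noteq> \<one>\<^bsub>H\<^esub> \<and> h \<notin> f ` S"
    using notin[OF x(1,3)] f.hom_closed[OF x(1)] by blast
  ultimately have "graph_diameter (cayley_graph H (f ` S)) = 2"
    by (rule cayley_diameter_eq_2[OF H.is_group S'])
  moreover have "regular_graph (cayley_graph H (f ` S)) (card S)"
    unfolding regular_cayley_graph_iff[OF H.is_group S']
    using inj_on_subset[OF inj SG] by (rule card_image)
  moreover have "order H = order G" "finite (carrier H)"
    using inj fin unfolding order_def H_def by (simp_all add: card_image)
  ultimately show ?thesis
    unfolding abelian_cayley_orders_def using H.comm_group_axioms S'
    by (intro CollectI exI[of _ H] exI[of _ "f ` S"]) simp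
qed

section \<open>The layered connection set\<close>

text \<open>Inversion is an involution, so closure under it already makes the image of
  \<open>S\<close> all of \<open>S\<close>.\<close>

lemma (in group) connection_setI:
  assumes "S \<subseteq> carrier G" "\<And>s. s \<in> S \<Longrightarrow> inv s \<in> S" "\<one> \<notin> S"
  shows "connection_set G S"
proof -
  have "s \<in> (\<lambda>s. inv s) ` S" if "s \<in> S" for s
    using assms(1,2) that by (intro image_eqI[of _ _ "inv s"]) auto
  thus ?thesis using assms unfolding connection_set_def by auto
qed

lemma DirProd_comm_group:
  assumes "comm_group G" "comm_group H"
  shows "comm_group (G \<times>\<times> H)"
proof -
  interpret G: comm_group G by (rule assms)
  interpret H: comm_group H by (rule assms)
  interpret group "G \<times>\<times> H" by (intro DirProd_group G.is_group H.is_group)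
  show ?thesis by (intro group_comm_groupI) (auto simp: G.m_comm H.m_comm)
qed

text \<open>The combinatorial core, free of fields. Points of the 5 by 5 grid carry subsets of
  \<open>G\<close>, and a layer is covered when its point is a sum of two points whose subsets
  multiply to all of \<open>G\<close>. The \<open>+ 1\<close> in the valency stands for a pair of
  singleton layers.\<close>

lemma (in comm_group) layered_order_in_abelian_cayley_orders:
  assumes fin: "finite (carrier G)" and E: "E \<subseteq> carrier G"
    and N: "subgroup N1 G" "subgroup N2 G" "subgroup N3 G"
    and EN: "E <#> N1 = carrier G" "E <#> N2 = carrier G" "E <#> N3 = carrier G"
    and NN: "N1 <#> N2 = carrier G" "N1 <#> N3 = carrier G" "N2 <#> N3 = carrier G"
    and EE: "\<And>a. a \<in> carrier G \<Longrightarrow> a \<in> N1 \<union> N2 \<union> N3 \<or> (\<exists>u\<in>E. \<exists>v\<in>E. a = u \<otimes> inv v)"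
  shows "25 * order G \<in> abelian_cayley_orders (2 * (card E + card N1 + card N2 + card N3 + 1)) 2"
proof -
  define E' where "E' = (\<lambda>u. inv u) ` E"
  \<comment> \<open>Modulo 5, \<open>4 = -1\<close> and \<open>3 = -2\<close>: opposite points carry
    mutually inverse sets, either \<open>E\<close> and \<open>E'\<close> or twice the same subgroup.
    Hence \<open>S\<close> is closed under inversion.\<close>
  define T where "T h = (if h = (1, 0) then E else if h = (4, 0) then E'
      else if h \<in> {(2, 0), (3, 0)} then N1 else if h \<in> {(0, 1), (0, 4)} then N2
      else if h \<in> {(0, 2), (0, 3)} then N3 else {\<one>})" for h :: "int \<times> int"
  \<comment> \<open>The layers \<open>(1, 1)\<close> and \<open>(4, 4)\<close> are not needed for covering; they only pad the valency by 2.\<close>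
  define Z :: "(int \<times> int) set"
    where "Z = {(1, 0), (4, 0), (2, 0), (3, 0), (0, 1), (0, 4), (0, 2), (0, 3), (1, 1), (4, 4)}"
  define S where "S = Sigma Z T"
  let ?Z5 = "integer_mod_group 5"
  let ?H = "(?Z5 \<times>\<times> ?Z5) \<times>\<times> G"
  interpret Z: group "?Z5 \<times>\<times> ?Z5" by (intro DirProd_group) simp_all
  interpret H: comm_group ?H
    by (intro DirProd_comm_group abelian_integer_mod_group comm_group_axioms)
  have carr: "carrier ?H = ({0..4} \<times> {0..4}) \<times> carrier G"
    by (auto simp: carrier_integer_mod_group)
  have NG: "N1 \<subseteq> carrier G" "N2 \<subseteq> carrier G" "N3 \<subseteq> carrier G"
    using N by (auto dest: subgroup.subset)
  have E'G: "E' \<subseteq> carrier G" using E unfolding E'_def by auto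
  have TG: "T h \<subseteq> carrier G" for h
    using E E'G NG by (auto simp: T_def)
  have T: "T (1, 0) = E" "T (4, 0) = E'" "T (2, 0) = N1" "T (3, 0) = N1" "T (0, 1) = N2"
      "T (0, 4) = N2" "T (0, 2) = N3" "T (0, 3) = N3" "T (1, 1) = {\<one>}" "T (4, 4) = {\<one>}"
    by (simp_all add: T_def)
  have N_inv: "x \<in> N1 \<Longrightarrow> inv x \<in> N1" "x \<in> N2 \<Longrightarrow> inv x \<in> N2" "x \<in> N3 \<Longrightarrow> inv x \<in> N3" for x
    using N by (simp_all add: subgroup.m_inv_closed)
  have E_inv: "x \<in> E \<Longrightarrow> inv x \<in> E'" "x \<in> E' \<Longrightarrow> inv x \<in> E" for x
    using E unfolding E'_def by auto
  have Zc: "Z \<subseteq> {0..4} \<times> {0..4}" by (auto simp: Z_def)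
  have SH: "S \<subseteq> carrier ?H" unfolding carr S_def using TG Zc by blast
  have conn: "connection_set ?H S"
  proof (rule H.connection_setI[OF SH])
    show "\<one>\<^bsub>?H\<^esub> \<notin> S" by (auto simp: S_def Z_def)
  next
    fix s assume s: "s \<in> S"
    obtain i j u where s_eq: "s = ((i, j), u)" by (metis prod.exhaust)
    have ij: "(i, j) \<in> Z" and u: "u \<in> T (i, j)" using s unfolding s_eq S_def by auto
    have "i \<in> {0..4}" "j \<in> {0..4}" "u \<in> carrier G" using ij u Zc TG by auto
    hence inv: "inv\<^bsub>?H\<^esub> s = ((- i mod 5, - j mod 5), inv u)"
      unfolding s_eq by (simp add: inv_DirProd carrier_integer_mod_group Z.is_group is_group)
    have "(- i mod 5, - j mod 5) \<in> Z \<and> inv u \<in> T (- i mod 5, - j mod 5)"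
      using ij[unfolded Z_def] u
      by (elim insertE emptyE) (simp_all add: T Z_def N_inv E_inv)
    thus "inv\<^bsub>?H\<^esub> s \<in> S" unfolding inv S_def by auto
  qed
  have "card S = (\<Sum>h\<in>Z. card (T h))"
    unfolding S_def using TG fin by (intro card_SigmaI) (auto simp: Z_def intro: finite_subset)
  also have "\<dots> = 2 * (card E + card N1 + card N2 + card N3 + 1)"
  proof -
    have "inj_on (\<lambda>u. inv u) E"
      by (rule inj_on_inverseI[where g = "\<lambda>u. inv u"]) (use E in auto)
    hence "card E' = card E" unfolding E'_def by (rule card_image)
    thus ?thesis by (simp add: Z_def T)
  qed
  finally have cardS: "card S = 2 * (card E + card N1 + card N2 + card N3 + 1)" .
  define P where "P h \<longleftrightarrow> (\<forall>a\<in>carrier G. \<exists>s\<in>S. \<exists>t\<in>S. (h, a) = s \<otimes>\<^bsub>?H\<^esub> t)" for h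
  have layer: "P ((i + i') mod 5, (j + j') mod 5)"
    if ij: "(i, j) \<in> Z" "(i', j') \<in> Z" and prod: "T (i, j) <#> T (i', j') = carrier G" for i j i' j'
    unfolding P_def
  proof
    fix a assume "a \<in> carrier G"
    then obtain u v where "u \<in> T (i, j)" "v \<in> T (i', j')" "a = u \<otimes> v"
      unfolding prod[symmetric] set_mult_def by blast
    thus "\<exists>s\<in>S. \<exists>t\<in>S. (((i + i') mod 5, (j + j') mod 5), a) = s \<otimes>\<^bsub>?H\<^esub> t"
      using ij unfolding S_def
      by (intro bexI[of _ "((i, j), u)"] bexI[of _ "((i', j'), v)"]) auto
  qed
  \<comment> \<open>Inverting \<open>inv a = u \<otimes> v\<close> exchanges \<open>E\<close> for
    \<open>E'\<close> and preserves the subgroup, so whatever complements \<open>E\<close> also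
    complements \<open>E'\<close>.\<close>
  have E'N: "E' <#> M = carrier G" if M: "subgroup M G" "E <#> M = carrier G" for M
  proof
    show "E' <#> M \<subseteq> carrier G" using E'G subgroup.subset[OF M(1)] unfolding set_mult_def by blast
    show "carrier G \<subseteq> E' <#> M"
    proof
      fix a assume a: "a \<in> carrier G"
      hence "inv a \<in> E <#> M" unfolding M(2) by simp
      then obtain u v where uv: "u \<in> E" "v \<in> M" "inv a = u \<otimes> v" unfolding set_mult_def by blast
      have "u \<in> carrier G" "v \<in> carrier G" using uv E subgroup.subset[OF M(1)] by auto
      hence "a = inv u \<otimes> inv v" using a uv(3) by (metis inv_inv inv_mult)
      thus "a \<in> E' <#> M"
        using uv subgroup.m_inv_closed[OF M(1)] unfolding set_mult_def E'_def by blast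
    qed
  qed
  note prods = EN NN E'N[OF N(1) EN(1)] E'N[OF N(2) EN(2)] E'N[OF N(3) EN(3)]
  have base: "(i, j) = (0, 0) \<or> P (i, j)" if "i \<in> {0..4}" "j \<in> {0..4}" for i j
  proof -
    \<comment> \<open>On the first axis \<open>E\<close> or \<open>E'\<close> meets
      \<open>N1\<close>, on the second \<open>N2\<close> meets \<open>N3\<close>, through sums such
      as \<open>1 = 4 + 2\<close> and \<open>2 = 4 + 3\<close> modulo 5.\<close>
    have "P (1, 0)" "P (2, 0)" "P (3, 0)" "P (4, 0)"
      using layer[of 4 0 2 0] layer[of 4 0 3 0] layer[of 1 0 2 0] layer[of 1 0 3 0] prods
      by (simp_all add: T Z_def)
    moreover have "P (0, 1)" "P (0, 2)" "P (0, 3)" "P (0, 4)"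
      using layer[of 0 4 0 2] layer[of 0 4 0 3] layer[of 0 1 0 2] layer[of 0 1 0 3] prods
      by (simp_all add: T Z_def)
    \<comment> \<open>Off the axes, \<open>(i, j) = (i, 0) + (0, j)\<close> pairs one of
      \<open>E\<close>, \<open>E'\<close>, \<open>N1\<close> with \<open>N2\<close> or
      \<open>N3\<close>.\<close>
    moreover have "P (1, 1)" "P (1, 2)" "P (1, 3)" "P (1, 4)"
      using layer[of 1 0 0 1] layer[of 1 0 0 2] layer[of 1 0 0 3] layer[of 1 0 0 4] prods
      by (simp_all add: T Z_def)
    moreover have "P (2, 1)" "P (2, 2)" "P (2, 3)" "P (2, 4)"
      using layer[of 2 0 0 1] layer[of 2 0 0 2] layer[of 2 0 0 3] layer[of 2 0 0 4] prods
      by (simp_all add: T Z_def)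
    moreover have "P (3, 1)" "P (3, 2)" "P (3, 3)" "P (3, 4)"
      using layer[of 3 0 0 1] layer[of 3 0 0 2] layer[of 3 0 0 3] layer[of 3 0 0 4] prods
      by (simp_all add: T Z_def)
    moreover have "P (4, 1)" "P (4, 2)" "P (4, 3)" "P (4, 4)"
      using layer[of 4 0 0 1] layer[of 4 0 0 2] layer[of 4 0 0 3] layer[of 4 0 0 4] prods
      by (simp_all add: T Z_def)
    moreover have "i = 0 \<or> i = 1 \<or> i = 2 \<or> i = 3 \<or> i = 4" "j = 0 \<or> j = 1 \<or> j = 2 \<or> j = 3 \<or> j = 4"
      using that by auto
    ultimately show ?thesis by auto
  qed
  \<comment> \<open>Over the zero point opposite layers are multiplied: two copies of a subgroup
    give its elements as \<open>a \<otimes> \<one>\<close>, and \<open>E\<close> with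
    \<open>E'\<close> gives the quotients.\<close>
  have zero: "\<exists>s\<in>S. \<exists>t\<in>S. ((0, 0), a) = s \<otimes>\<^bsub>?H\<^esub> t" if a: "a \<in> carrier G" for a
  proof -
    have *: ?thesis if "(i, j) \<in> Z" "u \<in> T (i, j)" "(i', j') \<in> Z" "v \<in> T (i', j')" "a = u \<otimes> v"
        "(i + i') mod 5 = 0" "(j + j') mod 5 = 0" for i j i' j' u v
      using that unfolding S_def
      by (intro bexI[of _ "((i, j), u)"] bexI[of _ "((i', j'), v)"]) auto
    from EE[OF a] consider "a \<in> N1" | "a \<in> N2" | "a \<in> N3" | u v where "u \<in> E" "v \<in> E" "a = u \<otimes> inv v"
      by blast
    thus ?thesis
    proof cases
      case 1
      thus ?thesis using *[of 2 0 a 3 0 \<one>] a subgroup.one_closed[OF N(1)] by (simp add: Z_def T)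
    next
      case 2
      thus ?thesis using *[of 0 1 a 0 4 \<one>] a subgroup.one_closed[OF N(2)] by (simp add: Z_def T)
    next
      case 3
      thus ?thesis using *[of 0 2 a 0 3 \<one>] a subgroup.one_closed[OF N(3)] by (simp add: Z_def T)
    next
      case 4
      thus ?thesis using *[of 1 0 u 4 0 "inv v"] by (simp add: Z_def T E_inv)
    qed
  qed
  have "order ?H \<in> abelian_cayley_orders (card S) 2"
  proof (rule order_in_abelian_cayley_orders[OF H.comm_group_axioms _ conn])
    show "finite (carrier ?H)" unfolding carr using fin by simp
    \<comment> \<open>No layer of \<open>S\<close> lies over the point
      \<open>(1, 2)\<close>.\<close>
    show "\<exists>g\<in>carrier ?H. g \<noteq> \<one>\<^bsub>?H\<^esub> \<and> g \<notin> S"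
      by (rule bexI[of _ "((1, 2), \<one>)"]) (auto simp: S_def Z_def carr simp del: carrier_DirProd)
  next
    fix g assume "g \<in> carrier ?H"
    then obtain i j a where g: "g = ((i, j), a)" "i \<in> {0..4}" "j \<in> {0..4}" "a \<in> carrier G"
      unfolding carr by auto
    have "\<exists>s\<in>S. \<exists>t\<in>S. g = s \<otimes>\<^bsub>?H\<^esub> t"
      using base[OF g(2,3)] zero[OF g(4)] g(4) unfolding g(1) P_def by blast
    thus "g = \<one>\<^bsub>?H\<^esub> \<or> g \<in> S \<or> (\<exists>s\<in>S. \<exists>t\<in>S. g = s \<otimes>\<^bsub>?H\<^esub> t)" by blast
  qed
  moreover have "order ?H = 25 * order G"
    unfolding order_def carr by (simp add: card_cartesian_product)
  ultimately show ?thesis unfolding cardS by simp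
qed

section \<open>The curve over a finite field\<close>

context comm_group
begin

interpretation GG: group "G \<times>\<times> G" by (intro DirProd_group is_group)

lemma subgroup_DirProd_axes_diagonal:
  shows "subgroup (carrier G \<times> {\<one>}) (G \<times>\<times> G)"
    and "subgroup ({\<one>} \<times> carrier G) (G \<times>\<times> G)"
    and "subgroup ((\<lambda>x. (x, x)) ` carrier G) (G \<times>\<times> G)"
  by (auto intro!: GG.subgroupI simp: is_group)

text \<open>The factorizations of \<open>(a, b)\<close> are \<open>(a, 1)(1, b)\<close>,
  \<open>(a b^-1, 1)(b, b)\<close> and \<open>(1, b a^-1)(a, a)\<close>; the last two come from
  solving \<open>a = x \<otimes> b\<close> for \<open>x\<close>.\<close>

lemma set_mult_DirProd_axes_diagonal:
  shows "(carrier G \<times> {\<one>}) <#>\<^bsub>G \<times>\<times> G\<^esub> ({\<one>} \<times> carrier G) = carrier (G \<times>\<times> G)"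
    and "(carrier G \<times> {\<one>}) <#>\<^bsub>G \<times>\<times> G\<^esub> ((\<lambda>x. (x, x)) ` carrier G) = carrier (G \<times>\<times> G)"
    and "({\<one>} \<times> carrier G) <#>\<^bsub>G \<times>\<times> G\<^esub> ((\<lambda>x. (x, x)) ` carrier G) = carrier (G \<times>\<times> G)"
proof -
  have "\<exists>x\<in>carrier G. a = x \<otimes> b" if "a \<in> carrier G" "b \<in> carrier G" for a b
    using that by (intro bexI[of _ "a \<otimes> inv b"]) (auto simp: m_assoc)
  thus "(carrier G \<times> {\<one>}) <#>\<^bsub>G \<times>\<times> G\<^esub> ({\<one>} \<times> carrier G) = carrier (G \<times>\<times> G)"
    and "(carrier G \<times> {\<one>}) <#>\<^bsub>G \<times>\<times> G\<^esub> ((\<lambda>x. (x, x)) ` carrier G) = carrier (G \<times>\<times> G)"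
    and "({\<one>} \<times> carrier G) <#>\<^bsub>G \<times>\<times> G\<^esub> ((\<lambda>x. (x, x)) ` carrier G) = carrier (G \<times>\<times> G)"
    by (auto simp: set_mult_def)
qed

end

section \<open>The completed line in the square of the unit group\<close>

context Ring.field
begin

lemmas units_of_field = units_of_carrier units_of_mult units_of_one field_Units

declare units_of_field [simp]

text \<open>The product of the line \<open>x + y = 1\<close> with an axis misses the pairs having
  \<open>1\<close> in the other coordinate, which \<open>(1, 1)\<close> restores; its product with
  the diagonal misses the pairs with \<open>a + b = 0\<close>, which \<open>(1, -1)\<close>
  restores.\<close>

definition line_curve :: "('a \<times> 'a) set" where
  "line_curve = (\<lambda>x. (x, \<one> \<ominus> x)) ` (carrier R - {\<zero>, \<one>}) \<union> {(\<one>, \<one>), (\<one>, \<ominus> \<one>)}"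

lemma line_curveI:
  assumes "x \<in> carrier R" "y \<in> carrier R" "x \<oplus> y = \<one>" "x \<noteq> \<zero>" "y \<noteq> \<zero>"
  shows "(x, y) \<in> line_curve"
proof -
  have "y = \<one> \<ominus> x" using assms(1,2) unfolding assms(3)[symmetric] by algebra
  moreover have "x \<noteq> \<one>" using assms calculation by (auto simp: minus_eq r_neg)
  ultimately show ?thesis using assms unfolding line_curve_def by auto
qed

lemma line_curve_one_one: "(\<one>, \<one>) \<in> line_curve" "(\<one>, \<ominus> \<one>) \<in> line_curve"
  unfolding line_curve_def by auto

lemma line_curve_subset: "line_curve \<subseteq> carrier (units_of R \<times>\<times> units_of R)"
proof -
  have "\<one> \<ominus> x \<noteq> \<zero>" if "x \<in> carrier R" "x \<noteq> \<one>" for x using that by (metis one_closed r_right_minus_eq)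
  moreover have "\<ominus> \<one> \<noteq> \<zero>" by (metis minus_minus minus_zero one_closed one_not_zero)
  ultimately show ?thesis unfolding line_curve_def by auto
qed

text \<open>The added points have first coordinate \<open>1\<close>, which the line part excludes,
  and they coincide precisely when \<open>1 = -1\<close>.\<close>

lemma card_line_curve:
  assumes fin: "finite (carrier R)"
  shows "card line_curve = card (carrier R) - 2 + (if \<one> = \<ominus> \<one> then 1 else 2)"
proof -
  let ?D = "(\<lambda>x. (x, \<one> \<ominus> x)) ` (carrier R - {\<zero>, \<one>})"
  have "card ?D = card (carrier R - {\<zero>, \<one>})" by (intro card_image) (auto simp: inj_on_def)
  also have "\<dots> = card (carrier R) - 2" using fin by (subst card_Diff_subset) auto
  finally have "card ?D = card (carrier R) - 2" .
  moreover have "?D \<inter> {(\<one>, \<one>), (\<one>, \<ominus> \<one>)} = {}" by auto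
  ultimately show ?thesis
    unfolding line_curve_def using fin by (subst card_Un_disjoint) auto
qed

interpretation M: comm_group "units_of R"
  by (rule units_comm_group)

text \<open>An axis leaves one coordinate of \<open>(a, b)\<close> fixed and the other free, so it
  can be completed to a point of the line; the diagonal allows division by \<open>a + b\<close>,
  which moves \<open>(a, b)\<close> onto the line. Where this fails, an added point steps
  in.\<close>

lemma line_curve_mult_eq_carrier:
  shows "line_curve <#>\<^bsub>units_of R \<times>\<times> units_of R\<^esub> (carrier (units_of R) \<times> {\<one>}) = carrier (units_of R \<times>\<times> units_of R)"
    (is "_ <#>\<^bsub>?H\<^esub> ?N1 = _")
    and "line_curve <#>\<^bsub>units_of R \<times>\<times> units_of R\<^esub> ({\<one>} \<times> carrier (units_of R)) = carrier (units_of R \<times>\<times> units_of R)"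
    (is "_ <#>\<^bsub>?H\<^esub> ?N2 = _")
    and "line_curve <#>\<^bsub>units_of R \<times>\<times> units_of R\<^esub> ((\<lambda>x. (x, x)) ` carrier (units_of R)) = carrier (units_of R \<times>\<times> units_of R)"
    (is "_ <#>\<^bsub>?H\<^esub> ?N3 = _")
proof -
  interpret H: group ?H by (intro DirProd_group M.is_group)
  have sub: "line_curve <#>\<^bsub>?H\<^esub> N \<subseteq> carrier ?H" if "N \<subseteq> carrier ?H" for N
    using line_curve_subset that by (rule H.set_mult_closed)
  have "(a, b) \<in> (line_curve <#>\<^bsub>?H\<^esub> ?N1) \<inter> (line_curve <#>\<^bsub>?H\<^esub> ?N2) \<inter> (line_curve <#>\<^bsub>?H\<^esub> ?N3)"
    if ab: "a \<in> carrier R" "a \<noteq> \<zero>" "b \<in> carrier R" "b \<noteq> \<zero>" for a b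
  proof (intro IntI)
    have inv: "inv x \<in> carrier R" "x \<otimes> inv x = \<one>" "inv x \<noteq> \<zero>" if "x \<in> carrier R" "x \<noteq> \<zero>" for x
    proof -
      have "x \<in> Units R" using that by simp
      thus "inv x \<in> carrier R" "x \<otimes> inv x = \<one>" by auto
      thus "inv x \<noteq> \<zero>" using that(1) by (metis r_null one_not_zero)
    qed
    show "(a, b) \<in> line_curve <#>\<^bsub>?H\<^esub> ?N1"
    proof (cases "b = \<one>")
      case True
      have "(a, b) = (\<one>, \<one>) \<otimes>\<^bsub>?H\<^esub> (a, \<one>)" using True ab by simp
      moreover have "(a, \<one>) \<in> ?N1" using ab by auto
      ultimately show ?thesis using line_curve_one_one unfolding set_mult_def by blast
    next
      case False
      define x where "x = \<one> \<ominus> b"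
      have x: "x \<in> carrier R" "x \<noteq> \<zero>" using ab False unfolding x_def by auto
      have "x \<oplus> b = \<one>" using ab unfolding x_def by algebra
      hence "(x, b) \<in> line_curve" using x ab by (intro line_curveI) auto
      moreover have "(a, b) = (x, b) \<otimes>\<^bsub>?H\<^esub> (inv x \<otimes> a, \<one>)"
        using ab x inv[of x] by (simp add: m_assoc[symmetric])
      moreover have "(inv x \<otimes> a, \<one>) \<in> ?N1" using ab x inv[of x] by (auto simp: integral_iff)
      ultimately show ?thesis unfolding set_mult_def by blast
    qed
    show "(a, b) \<in> line_curve <#>\<^bsub>?H\<^esub> ?N2"
    proof (cases "a = \<one>")
      case True
      have "(a, b) = (\<one>, \<one>) \<otimes>\<^bsub>?H\<^esub> (\<one>, b)" using True ab by simp
      moreover have "(\<one>, b) \<in> ?N2" using ab by auto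
      ultimately show ?thesis using line_curve_one_one unfolding set_mult_def by blast
    next
      case False
      define y where "y = \<one> \<ominus> a"
      have y: "y \<in> carrier R" "y \<noteq> \<zero>" using ab False unfolding y_def by auto
      have "a \<oplus> y = \<one>" using ab unfolding y_def by algebra
      hence "(a, y) \<in> line_curve" using y ab by (intro line_curveI) auto
      moreover have "(a, b) = (a, y) \<otimes>\<^bsub>?H\<^esub> (\<one>, inv y \<otimes> b)"
        using ab y inv[of y] by (simp add: m_assoc[symmetric])
      moreover have "(\<one>, inv y \<otimes> b) \<in> ?N2" using ab y inv[of y] by (auto simp: integral_iff)
      ultimately show ?thesis unfolding set_mult_def by blast
    qed
    show "(a, b) \<in> line_curve <#>\<^bsub>?H\<^esub> ?N3"
    proof (cases "a \<oplus> b = \<zero>")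
      case True
      hence "b = \<ominus> a" using ab by (metis minus_equality a_comm)
      hence "(a, b) = (\<one>, \<ominus> \<one>) \<otimes>\<^bsub>?H\<^esub> (a, a)" using ab by (simp add: l_minus)
      moreover have "(a, a) \<in> ?N3" using ab by auto
      ultimately show ?thesis using line_curve_one_one unfolding set_mult_def by blast
    next
      case False
      define s where "s = a \<oplus> b"
      have s: "s \<in> carrier R" "s \<noteq> \<zero>" using ab False unfolding s_def by auto
      have "a \<otimes> inv s \<oplus> b \<otimes> inv s = \<one>"
        using ab s inv[of s] by (simp add: l_distr[symmetric] s_def)
      hence "(a \<otimes> inv s, b \<otimes> inv s) \<in> line_curve"
        using s ab inv[of s] by (intro line_curveI) (auto simp: integral_iff)
      moreover have "(a, b) = (a \<otimes> inv s, b \<otimes> inv s) \<otimes>\<^bsub>?H\<^esub> (s, s)"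
        using ab s inv[of s] by (simp add: m_assoc m_comm[of "inv s"])
      moreover have "(s, s) \<in> ?N3" using s by auto
      ultimately show ?thesis unfolding set_mult_def by blast
    qed
  qed
  hence sup: "carrier ?H \<subseteq> (line_curve <#>\<^bsub>?H\<^esub> ?N1) \<inter> (line_curve <#>\<^bsub>?H\<^esub> ?N2) \<inter> (line_curve <#>\<^bsub>?H\<^esub> ?N3)"
    by auto
  have "?N1 \<subseteq> carrier ?H" "?N2 \<subseteq> carrier ?H" "?N3 \<subseteq> carrier ?H" by auto
  note le = this[THEN sub]
  show "line_curve <#>\<^bsub>?H\<^esub> ?N1 = carrier ?H" using le(1) sup by blast
  show "line_curve <#>\<^bsub>?H\<^esub> ?N2 = carrier ?H" using le(2) sup by blast
  show "line_curve <#>\<^bsub>?H\<^esub> ?N3 = carrier ?H" using le(3) sup by blast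
qed

text \<open>Sought is a point \<open>(y, z)\<close> of the line with \<open>(a y, b z)\<close> on
  the line as well: \<open>y + z = 1\<close> and \<open>a y + b z = 1\<close>. This system is
  solvable as \<open>a \<noteq> b\<close>, with \<open>y \<noteq> 0\<close> from
  \<open>b \<noteq> 1\<close> and \<open>z \<noteq> 0\<close> from
  \<open>a \<noteq> 1\<close>.\<close>

lemma line_curve_quotients:
  assumes "(a, b) \<in> carrier (units_of R \<times>\<times> units_of R)" "a \<noteq> \<one>" "b \<noteq> \<one>" "a \<noteq> b"
  shows "\<exists>u\<in>line_curve. \<exists>v\<in>line_curve. (a, b) = u \<otimes>\<^bsub>units_of R \<times>\<times> units_of R\<^esub> inv\<^bsub>units_of R \<times>\<times> units_of R\<^esub> v"
proof -
  let ?H = "units_of R \<times>\<times> units_of R"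
  interpret H: group ?H by (intro DirProd_group M.is_group)
  have ab: "a \<in> carrier R" "b \<in> carrier R" "a \<noteq> \<zero>" "b \<noteq> \<zero>" using assms(1) by auto
  \<comment> \<open>Up to sign \<open>w\<close> inverts the determinant of the linear system;
    \<open>y\<close> and \<open>z\<close> below are given by Cramer's rule.\<close>
  define w where "w = inv (a \<ominus> b)"
  have "a \<ominus> b \<in> Units R" using ab assms(4) by (simp add: field_Units)
  hence w: "w \<in> carrier R" "(a \<ominus> b) \<otimes> w = \<one>" unfolding w_def by auto
  define y where "y = (\<one> \<ominus> b) \<otimes> w"
  define z where "z = (a \<ominus> \<one>) \<otimes> w"
  have w0: "w \<noteq> \<zero>" using w ab by (metis minus_closed one_not_zero r_null)
  have yz: "y \<in> carrier R" "z \<in> carrier R" "y \<noteq> \<zero>" "z \<noteq> \<zero>"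
    using ab w assms(2,3) w0 by (auto simp: y_def z_def integral_iff)
  have "y \<oplus> z = (a \<ominus> b) \<otimes> w" unfolding y_def z_def using ab w(1) by algebra
  hence v: "(y, z) \<in> line_curve" using yz w(2) by (intro line_curveI) auto
  have "a \<otimes> y \<oplus> b \<otimes> z = (a \<ominus> b) \<otimes> w" unfolding y_def z_def using ab w(1) by algebra
  hence u: "(a \<otimes> y, b \<otimes> z) \<in> line_curve"
    using ab yz w(2) by (intro line_curveI) (auto simp: integral_iff)
  have "(a, b) = (a \<otimes> y, b \<otimes> z) \<otimes>\<^bsub>?H\<^esub> inv\<^bsub>?H\<^esub> (y, z)"
    by (subst H.inv_solve_right[OF assms(1) subsetD[OF line_curve_subset u]
          subsetD[OF line_curve_subset v]]) simp
  thus ?thesis using u v by blast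
qed

section \<open>Orders and valencies of the resulting graphs\<close>

lemma units_pairs_order_in_abelian_cayley_orders:
  assumes fin: "finite (carrier R)"
  defines "n \<equiv> card (carrier R) - 1"
  shows "25 * n\<^sup>2 \<in> abelian_cayley_orders (2 * (card line_curve + 3 * n + 1)) 2"
proof -
  let ?H = "units_of R \<times>\<times> units_of R" and ?U = "carrier (units_of R)"
  interpret H: comm_group ?H by (intro DirProd_comm_group M.comm_group_axioms)
  have one: "\<one>\<^bsub>units_of R\<^esub> = \<one>" by simp
  have U: "finite ?U" "card ?U = n" using fin by (simp_all add: n_def)
  have "25 * order ?H \<in> abelian_cayley_orders (2 * (card line_curve + card (?U \<times> {\<one>})
      + card ({\<one>} \<times> ?U) + card ((\<lambda>x. (x, x)) ` ?U) + 1)) 2"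
  proof (rule H.layered_order_in_abelian_cayley_orders)
    show "finite (carrier ?H)" using fin by simp
    fix c assume c: "c \<in> carrier ?H"
    obtain a b where ab: "c = (a, b)" by (cases c)
    show "c \<in> (?U \<times> {\<one>}) \<union> ({\<one>} \<times> ?U) \<union> (\<lambda>x. (x, x)) ` ?U \<or>
        (\<exists>u\<in>line_curve. \<exists>v\<in>line_curve. c = u \<otimes>\<^bsub>?H\<^esub> inv\<^bsub>?H\<^esub> v)"
    proof (cases "a = \<one> \<or> b = \<one> \<or> a = b")
      case True
      thus ?thesis using c unfolding ab by auto
    next
      case False
      thus ?thesis using line_curve_quotients c unfolding ab by blast
    qed
  qed (fact line_curve_subset line_curve_mult_eq_carrier
      M.subgroup_DirProd_axes_diagonal[unfolded one] M.set_mult_DirProd_axes_diagonal[unfolded one])+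
  moreover have "card (?U \<times> {\<one>}) = n" "card ({\<one>} \<times> ?U) = n"
    unfolding card_cartesian_product U(2) by simp_all
  moreover have "card ((\<lambda>x. (x, x)) ` ?U) = n"
    unfolding U(2)[symmetric] by (intro card_image) (auto simp: inj_on_def)
  moreover have "order ?H = n\<^sup>2"
    unfolding order_def carrier_DirProd card_cartesian_product U(2) by (simp add: power2_eq_square)
  moreover have "card line_curve + n + n + n + 1 = card line_curve + 3 * n + 1" by simp
  ultimately show ?thesis by metis
qed

text \<open>Both sides express characteristic two: \<open>1 = -1\<close> means that twice
  \<open>1\<close> vanishes, and a power of the characteristic \<open>p\<close> is even exactly when
  \<open>p = 2\<close>.\<close>

lemma one_eq_minus_one_iff_even:
  assumes pp: "primepow (card (carrier R))"
    and ch: "[aprimedivisor (card (carrier R))] \<cdot> \<one> = \<zero>"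
  shows "\<one> = \<ominus> \<one> \<longleftrightarrow> even (card (carrier R))"
proof -
  have two: "\<one> = \<ominus> \<one> \<longleftrightarrow> [(2::nat)] \<cdot> \<one> = \<zero>"
  proof
    assume "\<one> = \<ominus> \<one>"
    thus "[(2::nat)] \<cdot> \<one> = \<zero>" using r_neg[OF one_closed] by (simp add: numeral_2_eq_2)
  next
    assume "[(2::nat)] \<cdot> \<one> = \<zero>"
    hence "\<one> \<oplus> \<one> = \<zero>" by (simp add: numeral_2_eq_2)
    thus "\<one> = \<ominus> \<one>" using minus_equality by simp
  qed
  obtain p k where p: "Factorial_Ring.prime p" "k > 0" and q: "card (carrier R) = p ^ k"
    using pp unfolding primepow_def by blast
  have ap: "[p] \<cdot> \<one> = \<zero>" using ch aprimedivisor_prime_power[OF p] unfolding q by simp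
  show ?thesis
  proof (cases "even p")
    case True
    hence "p = 2" using p(1) primes_dvd_imp_eq two_is_prime_nat by blast
    thus ?thesis using two ap p(2) unfolding q by simp
  next
    case False
    have "[(2::nat)] \<cdot> \<one> \<noteq> \<zero>"
    proof
      assume ch2: "[(2::nat)] \<cdot> \<one> = \<zero>"
      \<comment> \<open>An odd \<open>p\<close> is \<open>m + 1\<close> with \<open>m\<close> even,
        so the vanishing of both multiples of \<open>1\<close> would give
        \<open>1 = 0\<close>.\<close>
      obtain m where m: "p = Suc m" "even m" using False by (cases p) auto
      have "[m] \<cdot> \<one> = \<zero>" by (rule add_pow_eq_zero[OF ch2 one_closed m(2)])
      thus False using ap unfolding m(1) by simp
    qed
    thus ?thesis using two False unfolding q by simp
  qed
qed

end

theorem theorem3p2: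
  fixes q d :: nat
  assumes "primepow q"
    and "d = (if even q then 8 * q - 6 else 8 * q - 4)"
  shows "real (AC d 2) \<ge>
    (if even q then 25 / 64 * (real d - 2)\<^sup>2 else 25 / 64 * (real d - 4)\<^sup>2)"
proof -
  obtain F :: "((int list \<times> nat) multiset \<Rightarrow> int) ring" where F: "Ring.field F" "finite (carrier F)"
      "card (carrier F) = q" "[aprimedivisor q] \<cdot>\<^bsub>F\<^esub> \<one>\<^bsub>F\<^esub> = \<zero>\<^bsub>F\<^esub>"
    using exists_finite_field[OF assms(1)] by blast
  interpret F: Ring.field F by (rule F(1))
  have q: "2 \<le> q" using primepow_gt_Suc_0[OF assms(1)] by simp
  have "card F.line_curve = q - 2 + (if even q then 1 else 2)"
    using F.card_line_curve[OF F(2)] F.one_eq_minus_one_iff_even F(3,4) assms(1) by simp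
  \<comment> \<open>Substituting \<open>q = m + 2\<close> removes the truncated subtractions. The
    valency is \<open>2 (4 q - 3)\<close> for even \<open>q\<close> and \<open>2 (4 q - 2)\<close>
    for odd \<open>q\<close>.\<close>
  moreover obtain m where "q = m + 2" using q le_Suc_ex add.commute by metis
  ultimately have "2 * (card F.line_curve + 3 * (q - 1) + 1) = d"
    using assms(2) by (cases "even q") simp_all
  hence "25 * (q - 1)\<^sup>2 \<in> abelian_cayley_orders d 2"
    using F.units_pairs_order_in_abelian_cayley_orders[OF F(2)] F(3) by simp
  hence "25 * (q - 1)\<^sup>2 \<le> AC d 2"
    unfolding AC_def by (intro Max_ge finite_abelian_cayley_orders)
  hence "real (25 * (q - 1)\<^sup>2) \<le> real (AC d 2)" by (rule of_nat_mono)
  hence "25 * (real q - 1)\<^sup>2 \<le> real (AC d 2)" using q by (simp add: of_nat_diff)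
  \<comment> \<open>In both cases the offset leaves \<open>8 (q - 1)\<close>, so the claimed bound
    equals \<open>25 (q - 1)^2\<close>, the order of the constructed group.\<close>
  moreover have "real d - (if even q then 2 else 4) = 8 * (real q - 1)"
    using assms(2) q by (simp add: of_nat_diff)
  hence "(real d - (if even q then 2 else 4))\<^sup>2 = 64 * (real q - 1)\<^sup>2"
    by (simp only: power_mult_distrib) simp
  ultimately show ?thesis by (cases "even q") simp_all
qed

end
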